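(* Let $D$ be a knot diagram, let $-D$ be $D$ with its orientation reversed, and let $D^*$ be the mirror image of $D$. Then $$W_{-D}(t)=W_{D^*}(t)=t^{c}\,W_D(t^{-1}),$$ where $c=c(D)$.
   Context: All knot diagrams are oriented and lie on $S^2$. $c(D)$ is the number of crossings of the diagram $D$. The mirror image $D^*$ is the diagram obtained from $D$ by switching over and under at every crossing, keeping the orientation. A base point $b$ of a knot diagram $D$ is a point of $D$ that is not a crossing point. A crossing point of $D$ is a warping crossing point of $D_b=(D,b)$ if, going along $D$ following its orientation starting from $b$, one meets that crossing first as an under-crossing. The warping degree $d(D_b)$ is the number of warping crossing points of $D_b$. An edge of $D$ is a path on $D$ between (consecutive) crossing points with no crossings in its interior; for the diagram with no crossings, the whole circle counts as one edge. The warping degree $i(e)$ of an edge $e$ is $d(D_b)$ for any base point $b$ on $e$. The warping polynomial of $D$ is $W_D(t)=\sum_e t^{i(e)}$, the sum over all edges $e$ of $D$. *)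

theory Defs
  imports "HOL-Analysis.Analysis" "HOL-Computational_Algebra.Polynomial"
begin

text \<open>
  An oriented knot diagram on \<open>S\<^sup>2\<close> is given by a 1-periodic parametrization
  \<open>curve\<close> of a closed curve on the unit sphere (so parameters live in \<open>\<real>/\<int>\<close>, and the
  orientation is the direction of increasing parameter), together with the over/under
  information: at a crossing \<open>curve s = curve t\<close>, the strand through the parameter \<open>s\<close>
  is the upper one iff \<open>over s\<close>. The value of \<open>over\<close> at a parameter that is not mapped
  to a crossing point has no meaning and is never used.
\<close>

record knot_diagram =
  curve :: "real \<Rightarrow> real ^ 3"
  over :: "real \<Rightarrow> bool"

definition crossings :: "knot_diagram \<Rightarrow> (real ^ 3) set" where
  "crossings D = {p. \<exists>s t. s - t \<notin> \<int> \<and> curve D s = p \<and> curve D t = p}"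

text \<open>
  Exactly two strands pass through \<open>p\<close>, and in a suitable local chart \<open>h\<close> of the sphere
  one of them runs along the real axis and the other along the imaginary axis. (Both
  strands are locally injective when there are only finitely many crossings, so they do
  pass through each other.) This covers smooth curves with transverse self-intersections
  as well as polygonal ones.
\<close>

definition transverse_double_point :: "knot_diagram \<Rightarrow> real ^ 3 \<Rightarrow> bool" where
  "transverse_double_point D p \<longleftrightarrow>
     (\<exists>s t. s - t \<notin> \<int> \<and> curve D s = p \<and> curve D t = p \<and>
        (\<forall>u. curve D u = p \<longrightarrow> u - s \<in> \<int> \<or> u - t \<in> \<int>) \<and>
        (\<exists>U V h k e. openin (top_of_set (sphere 0 1)) U \<and> open (V :: complex set) \<and>
           homeomorphism U V h k \<and> e > 0 \<and>
           (\<forall>u. \<bar>u - s\<bar> < e \<longrightarrow> curve D u \<in> U \<and> Im (h (curve D u)) = 0) \<and>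
           (\<forall>u. \<bar>u - t\<bar> < e \<longrightarrow> curve D u \<in> U \<and> Re (h (curve D u)) = 0)))"

definition is_knot_diagram :: "knot_diagram \<Rightarrow> bool" where
  "is_knot_diagram D \<longleftrightarrow>
     continuous_on UNIV (curve D) \<and>
     (\<forall>t. curve D t \<in> sphere 0 1) \<and>
     (\<forall>t. curve D (t + 1) = curve D t) \<and>
     (\<forall>t. over D (t + 1) = over D t) \<and>
     finite (crossings D) \<and>
     (\<forall>p\<in>crossings D. transverse_double_point D p) \<and>
     (\<forall>s t. s - t \<notin> \<int> \<and> curve D s = curve D t \<longrightarrow> over D s \<noteq> over D t)"

definition crossing_number :: "knot_diagram \<Rightarrow> nat" where
  "crossing_number D = card (crossings D)"

definition reverse_diagram :: "knot_diagram \<Rightarrow> knot_diagram" where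
  "reverse_diagram D = \<lparr>curve = (\<lambda>t. curve D (- t)), over = (\<lambda>t. over D (- t))\<rparr>"

definition mirror_diagram :: "knot_diagram \<Rightarrow> knot_diagram" where
  "mirror_diagram D = \<lparr>curve = curve D, over = (\<lambda>t. \<not> over D t)\<rparr>"

definition base_points :: "knot_diagram \<Rightarrow> (real ^ 3) set" where
  "base_points D = range (curve D) - crossings D"

text \<open>The parameter \<open>t\<close> below is the first visit to \<open>p\<close> after starting from \<open>b\<close>.\<close>

definition warping_crossings :: "knot_diagram \<Rightarrow> real ^ 3 \<Rightarrow> (real ^ 3) set" where
  "warping_crossings D b =
     {p \<in> crossings D. \<exists>s t. curve D s = b \<and> s < t \<and> curve D t = p \<and>
        (\<forall>u\<in>{s<..<t}. curve D u \<noteq> p) \<and> \<not> over D t}"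

definition warping_degree :: "knot_diagram \<Rightarrow> real ^ 3 \<Rightarrow> nat" where
  "warping_degree D b = card (warping_crossings D b)"

text \<open>Edges are point sets, end points included.\<close>

definition edges :: "knot_diagram \<Rightarrow> (real ^ 3) set set" where
  "edges D =
     (if crossings D = {} then {range (curve D)}
      else {curve D ` {s..t} | s t. s < t \<and> curve D s \<in> crossings D \<and> curve D t \<in> crossings D \<and>
              (\<forall>u\<in>{s<..<t}. curve D u \<notin> crossings D)})"

definition edge_warping_degree :: "knot_diagram \<Rightarrow> (real ^ 3) set \<Rightarrow> nat" where
  "edge_warping_degree D e = (THE n. \<forall>b \<in> e \<inter> base_points D. warping_degree D b = n)"

definition warping_polynomial :: "knot_diagram \<Rightarrow> int poly" where
  "warping_polynomial D = (\<Sum>e\<in>edges D. monom 1 (edge_warping_degree D e))"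

end

theory Submission
  imports Defs
begin

text \<open>
  Fix a base point \<open>b\<close> and a crossing \<open>p\<close>. Going once around the diagram from \<open>b\<close> one meets
  \<open>p\<close> exactly twice, once on each strand, and \<open>p\<close> is warping iff the strand met first is the
  lower one. The mirror image keeps the order of the two visits and exchanges their heights; the
  reversed diagram keeps the heights and exchanges the order. Either operation therefore
  turns the set of warping crossings into its complement among all crossings
  (\<open>warping_crossings_mirror\<close>, \<open>warping_crossings_reverse\<close>), so that
  \<open>d\<close> becomes \<open>c - d\<close> at every base point.

  Both operations also keep the point sets that are the edges. Since the warping
  degree does not change while the base point moves inside an edge
  (\<open>warping_crossings_eq_if_no_crossing_between\<close>), every edge has a warping degree, realised at
  any base point on it, and \<open>i(e)\<close> becomes \<open>c - i(e)\<close>. Both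
  transformed polynomials are thus equal to \<open>\<Sum>\<^sub>e t ^ (c - i(e))\<close>, and \<open>i(e) \<le> c\<close> gives
  the evaluation formula.
\<close>

section \<open>Reversal and mirror image of a diagram\<close>

lemma reverse_sel [simp]:
  "curve (reverse_diagram D) t = curve D (- t)"
  "over (reverse_diagram D) t = over D (- t)"
  by (simp_all add: reverse_diagram_def)

lemma curve_reverse: "curve (reverse_diagram D) = (\<lambda>t. curve D (- t))"
  by (simp add: reverse_diagram_def)

lemma mirror_sel [simp]:
  "curve (mirror_diagram D) = curve D"
  "over (mirror_diagram D) t \<longleftrightarrow> \<not> over D t"
  by (simp_all add: mirror_diagram_def)

lemma reverse_reverse [simp]: "reverse_diagram (reverse_diagram D) = D"
  by (simp add: reverse_diagram_def)

lemma uminus_diff_Ints_iff: "- s - - t \<in> \<int> \<longleftrightarrow> s - t \<in> (\<int> :: real set)"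
  by (metis minus_diff_minus minus_in_Ints_iff)

lemma range_curve_reverse [simp]: "range (curve (reverse_diagram D)) = range (curve D)"
proof -
  have "range (curve (reverse_diagram D)) = curve D ` range uminus"
    unfolding curve_reverse image_image ..
  then show ?thesis by simp
qed

lemma crossings_reverse [simp]: "crossings (reverse_diagram D) = crossings D"
proof -
  have sub: "crossings D \<subseteq> crossings (reverse_diagram D)" for D
    unfolding crossings_def reverse_sel
    by (clarify, metis uminus_diff_Ints_iff minus_minus)
  from sub[of D] sub[of "reverse_diagram D"] show ?thesis by simp
qed

lemma crossings_mirror [simp]: "crossings (mirror_diagram D) = crossings D"
  by (simp add: crossings_def)

lemma base_points_reverse [simp]: "base_points (reverse_diagram D) = base_points D"
  by (simp add: base_points_def del: reverse_sel)

lemma base_points_mirror [simp]: "base_points (mirror_diagram D) = base_points D"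
  by (simp add: base_points_def)

lemma edges_mirror [simp]: "edges (mirror_diagram D) = edges D"
  by (simp add: edges_def)

lemma edges_reverse [simp]: "edges (reverse_diagram D) = edges D"
proof -
  have sub: "edges D \<subseteq> edges (reverse_diagram D)" for D
  proof
    fix e assume e: "e \<in> edges D"
    show "e \<in> edges (reverse_diagram D)"
    proof (cases "crossings D = {}")
      case True
      then show ?thesis using e by (simp add: edges_def del: reverse_sel)
    next
      case False
      then obtain s t where st: "e = curve D ` {s..t}" "s < t" "curve D s \<in> crossings D"
        "curve D t \<in> crossings D" "\<forall>u\<in>{s<..<t}. curve D u \<notin> crossings D"
        using e by (auto simp: edges_def)
      have "curve (reverse_diagram D) ` {-t..-s} = curve D ` uminus ` {-t..-s}"
        unfolding curve_reverse image_image ..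
      then have "e = curve (reverse_diagram D) ` {-t..-s}"
        using st(1) by simp
      moreover have "\<forall>u\<in>{-t<..<-s}. curve D (- u) \<notin> crossings D"
        using st(5) by auto
      ultimately have "\<exists>s' t'. e = curve (reverse_diagram D) ` {s'..t'} \<and> s' < t' \<and>
          curve (reverse_diagram D) s' \<in> crossings D \<and>
          curve (reverse_diagram D) t' \<in> crossings D \<and>
          (\<forall>u\<in>{s'<..<t'}. curve (reverse_diagram D) u \<notin> crossings D)"
        using st(2-4) by (intro exI[of _ "-t"] exI[of _ "-s"]) simp
      then show ?thesis using False by (simp add: edges_def del: reverse_sel)
    qed
  qed
  from sub[of D] sub[of "reverse_diagram D"] show ?thesis by simp
qed

lemma curve_add_int:
  assumes "is_knot_diagram D"
  shows "curve D (t + of_int n) = curve D t"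
proof -
  have step: "curve D (u + 1) = curve D u" for u
    using assms by (simp add: is_knot_diagram_def)
  have nat: "curve D (u + real m) = curve D u" for u m
  proof (induction m)
    case (Suc m)
    then show ?case using step[of "u + real m"] by (simp add: ac_simps)
  qed simp
  show ?thesis
    using nat[of t "nat n"] nat[of "t + of_int n" "nat (- n)"]
    by (cases "n \<ge> 0") auto
qed

lemma over_add_int:
  assumes "is_knot_diagram D"
  shows "over D (t + of_int n) = over D t"
proof -
  have step: "over D (u + 1) = over D u" for u
    using assms by (simp add: is_knot_diagram_def)
  have nat: "over D (u + real m) = over D u" for u m
  proof (induction m)
    case (Suc m)
    then show ?case using step[of "u + real m"] by (simp add: ac_simps)
  qed simp
  show ?thesis
    using nat[of t "nat n"] nat[of "t + of_int n" "nat (- n)"]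
    by (cases "n \<ge> 0") auto
qed

lemma is_knot_diagram_mirror:
  assumes "is_knot_diagram D"
  shows "is_knot_diagram (mirror_diagram D)"
  using assms by (simp add: is_knot_diagram_def transverse_double_point_def)

lemma is_knot_diagram_reverse:
  assumes D: "is_knot_diagram D"
  shows "is_knot_diagram (reverse_diagram D)"
proof -
  have "continuous_on UNIV (curve D)"
    using D by (simp add: is_knot_diagram_def)
  then have cont: "continuous_on UNIV (curve (reverse_diagram D))"
    unfolding curve_reverse
    by (rule continuous_on_compose2) (simp_all add: continuous_on_minus)
  have per: "curve D (- (t + 1)) = curve D (- t)" "over D (- (t + 1)) = over D (- t)" for t
    using curve_add_int[OF D, of "- t" "- 1"] over_add_int[OF D, of "- t" "- 1"] by simp_all
  \<comment> \<open>The charts of \<open>D\<close> serve again, with the two strands at \<open>- s\<close> and \<open>- t\<close>.\<close>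
  have transverse: "transverse_double_point (reverse_diagram D) p"
    if "transverse_double_point D p" for p
  proof -
    from that obtain s t U V h k e where st: "s - t \<notin> \<int>" "curve D s = p" "curve D t = p"
      and only: "\<forall>u. curve D u = p \<longrightarrow> u - s \<in> \<int> \<or> u - t \<in> \<int>"
      and chart: "openin (top_of_set (sphere 0 1)) U" "open (V :: complex set)"
        "homeomorphism U V h k" "e > 0"
      and axis: "\<forall>u. \<bar>u - s\<bar> < e \<longrightarrow> curve D u \<in> U \<and> Im (h (curve D u)) = 0"
        "\<forall>u. \<bar>u - t\<bar> < e \<longrightarrow> curve D u \<in> U \<and> Re (h (curve D u)) = 0"
      unfolding transverse_double_point_def by blast
    have abs: "\<bar>- u - v\<bar> = \<bar>u - - v\<bar>" for u v :: real by linarith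
    have st': "- s - - t \<notin> \<int>" using st(1) uminus_diff_Ints_iff by blast
    have only': "\<forall>u. curve D (- u) = p \<longrightarrow> u - - s \<in> \<int> \<or> u - - t \<in> \<int>"
      using only uminus_diff_Ints_iff by (metis minus_minus)
    have axis': "\<forall>u. \<bar>u - - s\<bar> < e \<longrightarrow> curve D (- u) \<in> U \<and> Im (h (curve D (- u))) = 0"
        "\<forall>u. \<bar>u - - t\<bar> < e \<longrightarrow> curve D (- u) \<in> U \<and> Re (h (curve D (- u))) = 0"
      using axis abs by metis+
    have "curve D (- (- s)) = p" "curve D (- (- t)) = p" using st(2,3) by simp_all
    then show ?thesis
      unfolding transverse_double_point_def reverse_sel
      using st' only' chart axis' by blast
  qed
  have "over D (- s) \<noteq> over D (- t)" if "s - t \<notin> \<int>" "curve D (- s) = curve D (- t)" for s t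
    using that D uminus_diff_Ints_iff[of s t] unfolding is_knot_diagram_def by blast
  then show ?thesis
    using D cont per transverse unfolding is_knot_diagram_def crossings_reverse reverse_sel
    by blast
qed

section \<open>The two visits to a crossing\<close>

lemma representative_after:
  fixes s t :: real
  obtains n :: int where "s \<le> t + of_int n" "t + of_int n < s + 1"
proof
  show "s \<le> t + of_int \<lceil>s - t\<rceil>" "t + of_int \<lceil>s - t\<rceil> < s + 1"
    by linarith+
qed

lemma Ints_close_eq_0:
  fixes x :: real
  assumes "x \<in> \<int>" "\<bar>x\<bar> < 1"
  shows "x = 0"
  using assms by (auto elim!: Ints_cases)

text \<open>
  The parameters of \<open>p\<close> form exactly two classes modulo the integers. Neither class contains
  \<open>s\<close>, so each has exactly one representative strictly between \<open>s\<close> and \<open>s + 1\<close>.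
\<close>

lemma two_visits_in_one_turn:
  assumes D: "is_knot_diagram D" and p: "p \<in> crossings D" and s: "curve D s \<noteq> p"
  obtains t\<^sub>1 t\<^sub>2 where "s < t\<^sub>1" "t\<^sub>1 < t\<^sub>2" "t\<^sub>2 < s + 1"
    "\<forall>u\<in>{s<..<s + 1}. curve D u = p \<longleftrightarrow> u = t\<^sub>1 \<or> u = t\<^sub>2"
    "over D t\<^sub>1 \<noteq> over D t\<^sub>2"
proof -
  from D p have "transverse_double_point D p"
    by (simp add: is_knot_diagram_def)
  then obtain x y where xy: "x - y \<notin> \<int>" "curve D x = p" "curve D y = p"
    and only: "\<And>u. curve D u = p \<Longrightarrow> u - x \<in> \<int> \<or> u - y \<in> \<int>"
    unfolding transverse_double_point_def by blast
  obtain m where m: "s \<le> x + of_int m" "x + of_int m < s + 1"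
    by (rule representative_after)
  obtain n where n: "s \<le> y + of_int n" "y + of_int n < s + 1"
    by (rule representative_after)
  define a b where "a = x + of_int m" and "b = y + of_int n"
  have ab: "curve D a = p" "curve D b = p"
    using xy curve_add_int[OF D] by (simp_all add: a_def b_def)
  have "s < a" "a < s + 1" "s < b" "b < s + 1"
    using m n ab s by (auto simp: a_def b_def order.order_iff_strict)
  note bounds = this
  have nI: "a - b \<notin> \<int>"
  proof
    assume "a - b \<in> \<int>"
    then have "(a - b) + of_int (n - m) \<in> \<int>" by (rule Ints_add[OF _ Ints_of_int])
    then show False using xy(1) by (simp add: a_def b_def algebra_simps)
  qed
  then have over: "over D a \<noteq> over D b"
    using D ab by (simp add: is_knot_diagram_def)
  have visits: "\<forall>u\<in>{s<..<s + 1}. curve D u = p \<longleftrightarrow> u = a \<or> u = b"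
  proof (intro ballI iffI)
    fix u assume u: "u \<in> {s<..<s + 1}"
    assume "curve D u = p"
    from only[OF this] have "u - x - of_int m \<in> \<int> \<or> u - y - of_int n \<in> \<int>"
      by (meson Ints_diff Ints_of_int)
    then have "u - a \<in> \<int> \<or> u - b \<in> \<int>"
      by (simp add: a_def b_def diff_diff_eq)
    moreover have "\<bar>u - a\<bar> < 1" "\<bar>u - b\<bar> < 1"
      using u bounds by auto
    ultimately show "u = a \<or> u = b"
      using Ints_close_eq_0[of "u - a"] Ints_close_eq_0[of "u - b"] by auto
  qed (use ab in auto)
  have "a \<noteq> b" using nI by auto
  then consider "a < b" | "b < a" by linarith
  then show thesis
  proof cases
    case 1
    then show thesis using that[of a b] bounds over visits by blast
  next
    case 2
    then show thesis using that[of b a] bounds over visits by blast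
  qed
qed

section \<open>Warping crossings\<close>

lemma warping_crossings_subset: "warping_crossings D b \<subseteq> crossings D"
  by (auto simp: warping_crossings_def)

text \<open>
  A base point has only one parameter up to integers, and shifting by an integer changes neither
  the curve nor the heights; so the first visit may be computed from any fixed parameter.
\<close>

lemma warping_iff_first_visit_under:
  assumes D: "is_knot_diagram D" and p: "p \<in> crossings D" and s: "curve D s \<notin> crossings D"
    and t: "s < t" "curve D t = p" "\<forall>u\<in>{s<..<t}. curve D u \<noteq> p"
  shows "p \<in> warping_crossings D (curve D s) \<longleftrightarrow> \<not> over D t"
proof
  assume "\<not> over D t"
  then show "p \<in> warping_crossings D (curve D s)"
    using p t by (auto simp: warping_crossings_def)
next
  assume "p \<in> warping_crossings D (curve D s)"
  then obtain s' t' where st': "curve D s' = curve D s" "s' < t'" "curve D t' = p"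
    "\<forall>u\<in>{s'<..<t'}. curve D u \<noteq> p" "\<not> over D t'"
    by (auto simp: warping_crossings_def)
  have "s' - s \<in> \<int>"
    using s st'(1) by (auto simp: crossings_def)
  then obtain n where n: "s' = s + of_int n"
    by (auto elim!: Ints_cases simp: algebra_simps)
  have "t' = t + of_int n"
  proof (rule linorder_cases)
    assume "t' < t + of_int n"
    then have "t' + of_int (- n) \<in> {s<..<t}" using st'(2) n by auto
    then show ?thesis using t(3) st'(3) curve_add_int[OF D, of t' "- n"] by metis
  next
    assume "t + of_int n < t'"
    then have "t + of_int n \<in> {s'<..<t'}" using t(1) n by auto
    then show ?thesis using st'(4) t(2) curve_add_int[OF D, of t n] by metis
  qed
  then show "\<not> over D t"
    using st'(5) over_add_int[OF D] by simp
qed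

lemma warping_crossings_mirror:
  assumes D: "is_knot_diagram D" and b: "b \<in> base_points D"
  shows "warping_crossings (mirror_diagram D) b = crossings D - warping_crossings D b"
proof -
  from b obtain s where s: "b = curve D s" "curve D s \<notin> crossings D"
    by (auto simp: base_points_def)
  have "p \<in> warping_crossings (mirror_diagram D) b \<longleftrightarrow> p \<notin> warping_crossings D b"
    if p: "p \<in> crossings D" for p
  proof -
    have "curve D s \<noteq> p" using s p by auto
    then obtain t\<^sub>1 t\<^sub>2 where
      t: "s < t\<^sub>1" "t\<^sub>1 < t\<^sub>2" "t\<^sub>2 < s + 1"
      "\<forall>u\<in>{s<..<s + 1}. curve D u = p \<longleftrightarrow> u = t\<^sub>1 \<or> u = t\<^sub>2"
      "over D t\<^sub>1 \<noteq> over D t\<^sub>2"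
      by (rule two_visits_in_one_turn[OF D p])
    have first: "curve D t\<^sub>1 = p" "\<forall>u\<in>{s<..<t\<^sub>1}. curve D u \<noteq> p"
      using t by auto
    show ?thesis
      using warping_iff_first_visit_under[OF D p s(2) t(1) first]
        warping_iff_first_visit_under[OF is_knot_diagram_mirror[OF D], of p s t\<^sub>1] p s t(1) first
      by simp
  qed
  then show ?thesis
    using warping_crossings_subset[of "mirror_diagram D" b] by auto
qed

text \<open>
  The first visit of the reversed diagram is the second visit \<open>t\<^sub>2\<close> of the original one,
  reached backwards from the end \<open>s + 1\<close> of the turn.
\<close>

lemma warping_crossings_reverse:
  assumes D: "is_knot_diagram D" and b: "b \<in> base_points D"
  shows "warping_crossings (reverse_diagram D) b = crossings D - warping_crossings D b"
proof -
  from b obtain s where s: "b = curve D s" "curve D s \<notin> crossings D"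
    by (auto simp: base_points_def)
  have s1: "curve D (s + 1) = curve D s"
    using D by (simp add: is_knot_diagram_def)
  have "p \<in> warping_crossings (reverse_diagram D) b \<longleftrightarrow> p \<notin> warping_crossings D b"
    if p: "p \<in> crossings D" for p
  proof -
    have "curve D s \<noteq> p" using s p by auto
    then obtain t\<^sub>1 t\<^sub>2 where
      t: "s < t\<^sub>1" "t\<^sub>1 < t\<^sub>2" "t\<^sub>2 < s + 1"
      "\<forall>u\<in>{s<..<s + 1}. curve D u = p \<longleftrightarrow> u = t\<^sub>1 \<or> u = t\<^sub>2"
      "over D t\<^sub>1 \<noteq> over D t\<^sub>2"
      by (rule two_visits_in_one_turn[OF D p])
    have first: "curve D t\<^sub>1 = p" "\<forall>u\<in>{s<..<t\<^sub>1}. curve D u \<noteq> p"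
      using t by auto
    have last: "curve D t\<^sub>2 = p" "\<forall>u\<in>{- (s + 1)<..<- t\<^sub>2}. curve D (- u) \<noteq> p"
      using t by auto
    have "p \<in> warping_crossings (reverse_diagram D) (curve (reverse_diagram D) (- (s + 1)))
        \<longleftrightarrow> \<not> over (reverse_diagram D) (- t\<^sub>2)"
      by (rule warping_iff_first_visit_under[OF is_knot_diagram_reverse[OF D]])
        (use p s s1 last t(3) in \<open>simp_all add: add.commute\<close>)
    then have "p \<in> warping_crossings (reverse_diagram D) b \<longleftrightarrow> \<not> over D t\<^sub>2"
      using s1 s(1) by (simp add: add.commute)
    then show ?thesis
      using warping_iff_first_visit_under[OF D p s(2) t(1) first] t(5) s(1) by simp
  qed
  then show ?thesis
    using warping_crossings_subset[of "reverse_diagram D" b] by auto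
qed

text \<open>
  No crossing is passed between \<open>u\<close> and \<open>v\<close>, so the first visit after \<open>u\<close> is also the
  first visit after \<open>v\<close>.
\<close>

lemma warping_crossings_eq_if_no_crossing_between:
  assumes D: "is_knot_diagram D" and "u \<le> v"
    and free: "\<forall>w\<in>{u..v}. curve D w \<notin> crossings D"
  shows "warping_crossings D (curve D u) = warping_crossings D (curve D v)"
proof -
  have uv: "curve D u \<notin> crossings D" "curve D v \<notin> crossings D"
    using assms by auto
  have "p \<in> warping_crossings D (curve D u) \<longleftrightarrow> p \<in> warping_crossings D (curve D v)"
    if p: "p \<in> crossings D" for p
  proof -
    have "curve D u \<noteq> p" using uv p by auto
    then obtain t\<^sub>1 t\<^sub>2 where
      t: "u < t\<^sub>1" "t\<^sub>1 < t\<^sub>2" "t\<^sub>2 < u + 1"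
      "\<forall>w\<in>{u<..<u + 1}. curve D w = p \<longleftrightarrow> w = t\<^sub>1 \<or> w = t\<^sub>2"
      "over D t\<^sub>1 \<noteq> over D t\<^sub>2"
      by (rule two_visits_in_one_turn[OF D p])
    have first: "curve D t\<^sub>1 = p" "\<forall>w\<in>{u<..<t\<^sub>1}. curve D w \<noteq> p"
      using t by auto
    have "t\<^sub>1 \<notin> {u..v}" using free first(1) p by auto
    then have v: "v < t\<^sub>1" using t(1) by auto
    have "\<forall>w\<in>{v<..<t\<^sub>1}. curve D w \<noteq> p" using first(2) \<open>u \<le> v\<close> by auto
    then show ?thesis
      using warping_iff_first_visit_under[OF D p uv(1) t(1) first]
        warping_iff_first_visit_under[OF D p uv(2) v first(1)] by simp
  qed
  then show ?thesis using warping_crossings_subset by blast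
qed

section \<open>Warping degrees of edges\<close>

lemma warping_degree_le:
  assumes "is_knot_diagram D"
  shows "warping_degree D b \<le> crossing_number D"
  unfolding warping_degree_def crossing_number_def
  by (rule card_mono) (use assms in \<open>simp_all add: is_knot_diagram_def warping_crossings_subset\<close>)

lemma edge_contains_base_point:
  assumes e: "e \<in> edges D"
  obtains b where "b \<in> e \<inter> base_points D"
proof (cases "crossings D = {}")
  case True
  then show thesis using that e by (auto simp: edges_def base_points_def)
next
  case False
  then obtain s t where st: "e = curve D ` {s..t}" "s < t"
    "\<forall>u\<in>{s<..<t}. curve D u \<notin> crossings D"
    using e by (auto simp: edges_def)
  obtain u where "s < u" "u < t" using dense[OF st(2)] by blast
  then have "curve D u \<in> e \<inter> base_points D"
    using st by (auto simp: base_points_def)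
  then show thesis by (rule that)
qed

text \<open>
  The end points of an edge are crossings, so base points on it have parameters strictly between
  those of the ends. On a diagram without crossings every warping degree is 0.
\<close>

lemma warping_degree_constant_on_edge:
  assumes D: "is_knot_diagram D" and e: "e \<in> edges D"
    and b: "b \<in> e \<inter> base_points D" and b': "b' \<in> e \<inter> base_points D"
  shows "warping_degree D b = warping_degree D b'"
proof (cases "crossings D = {}")
  case True
  then show ?thesis by (simp add: warping_degree_def warping_crossings_def)
next
  case False
  then obtain s t where st: "e = curve D ` {s..t}" "curve D s \<in> crossings D"
    "curve D t \<in> crossings D" "\<forall>u\<in>{s<..<t}. curve D u \<notin> crossings D"
    using e by (auto simp: edges_def)
  have interior: "\<exists>u. s < u \<and> u < t \<and> a = curve D u" if "a \<in> e \<inter> base_points D" for a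
  proof -
    from that st(1) obtain u where u: "u \<in> {s..t}" "a = curve D u" by auto
    have "a \<notin> crossings D" using that by (auto simp: base_points_def)
    then have "u \<noteq> s" "u \<noteq> t" using st u by auto
    then show ?thesis using u by force
  qed
  from interior[OF b] interior[OF b'] obtain u v where
    uv: "s < u" "u < t" "b = curve D u" "s < v" "v < t" "b' = curve D v" by blast
  have "warping_crossings D b = warping_crossings D b'"
  proof (cases "u \<le> v")
    case True
    then show ?thesis unfolding uv
      by (intro warping_crossings_eq_if_no_crossing_between[OF D]) (use st uv in auto)
  next
    case False
    then show ?thesis unfolding uv
      by (intro warping_crossings_eq_if_no_crossing_between[OF D, symmetric]) (use st uv in auto)
  qed
  then show ?thesis by (simp add: warping_degree_def)
qed

lemma edge_warping_degree_eq:
  assumes "is_knot_diagram D" "e \<in> edges D" "b \<in> e \<inter> base_points D"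
  shows "edge_warping_degree D e = warping_degree D b"
  unfolding edge_warping_degree_def
proof (rule the_equality)
  show "\<forall>b'\<in>e \<inter> base_points D. warping_degree D b' = warping_degree D b"
    using warping_degree_constant_on_edge[OF assms(1,2) _ assms(3)] by blast
qed (use assms(3) in metis)

lemma edge_warping_degree_le:
  assumes "is_knot_diagram D" "e \<in> edges D"
  shows "edge_warping_degree D e \<le> crossing_number D"
  using edge_contains_base_point[OF assms(2)] edge_warping_degree_eq[OF assms]
    warping_degree_le[OF assms(1)] by metis

text \<open>
  Both transformations enter only through what they do to edges, base points and warping
  crossings, so one lemma about a second diagram \<open>D'\<close> serves for the mirror image and the reverse.
\<close>

lemma edge_warping_degree_complement:
  assumes D: "is_knot_diagram D" and D': "is_knot_diagram D'"
    and same: "edges D' = edges D" "base_points D' = base_points D"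
    and compl: "\<And>b. b \<in> base_points D \<Longrightarrow>
      warping_crossings D' b = crossings D - warping_crossings D b"
    and e: "e \<in> edges D"
  shows "edge_warping_degree D' e = crossing_number D - edge_warping_degree D e"
proof -
  obtain b where b: "b \<in> e \<inter> base_points D"
    using edge_contains_base_point[OF e] by blast
  have "finite (crossings D)" using D by (simp add: is_knot_diagram_def)
  then have "warping_degree D' b = crossing_number D - warping_degree D b"
    using compl b by (simp add: warping_degree_def crossing_number_def card_Diff_subset
      warping_crossings_subset finite_subset[OF warping_crossings_subset])
  then show ?thesis
    using edge_warping_degree_eq[OF D e b] edge_warping_degree_eq[OF D', of e b] b e same by simp
qed

lemma warping_polynomial_mirror:
  assumes D: "is_knot_diagram D"
  shows "warping_polynomial (mirror_diagram D) =
    (\<Sum>e\<in>edges D. monom 1 (crossing_number D - edge_warping_degree D e))"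
  unfolding warping_polynomial_def edges_mirror
  by (intro sum.cong refl arg_cong[of _ _ "monom 1"]
      edge_warping_degree_complement[OF D is_knot_diagram_mirror[OF D]])
    (simp_all add: warping_crossings_mirror[OF D])

lemma warping_polynomial_reverse:
  assumes D: "is_knot_diagram D"
  shows "warping_polynomial (reverse_diagram D) =
    (\<Sum>e\<in>edges D. monom 1 (crossing_number D - edge_warping_degree D e))"
  unfolding warping_polynomial_def edges_reverse
  by (intro sum.cong refl arg_cong[of _ _ "monom 1"]
      edge_warping_degree_complement[OF D is_knot_diagram_reverse[OF D]])
    (simp_all add: warping_crossings_reverse[OF D])

section \<open>Evaluation of the warping polynomials\<close>

lemma poly_of_int_sum_monom:
  fixes x :: "'a::comm_ring_1"
  shows "poly (map_poly of_int (\<Sum>e\<in>E. monom 1 (f e))) x = (\<Sum>e\<in>E. x ^ f e)"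
proof -
  have add: "map_poly of_int (p + q) = map_poly of_int p + (map_poly of_int q :: 'a poly)" for p q
    by (rule poly_eqI) (simp add: coeff_map_poly)
  show ?thesis
    by (induction E rule: infinite_finite_induct) (simp_all add: add map_poly_monom poly_monom)
qed

theorem proposition2p8:
  fixes D :: knot_diagram and t :: "'a::field"
  assumes "is_knot_diagram D" and "t \<noteq> 0"
  shows "warping_polynomial (reverse_diagram D) = warping_polynomial (mirror_diagram D) \<and>
         poly (map_poly of_int (warping_polynomial (mirror_diagram D))) t =
           t ^ crossing_number D * poly (map_poly of_int (warping_polynomial D)) (inverse t)"
proof
  show "warping_polynomial (reverse_diagram D) = warping_polynomial (mirror_diagram D)"
    using assms(1) by (simp add: warping_polynomial_mirror warping_polynomial_reverse)
  have "t ^ (crossing_number D - edge_warping_degree D e) =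
      t ^ crossing_number D * inverse t ^ edge_warping_degree D e" if "e \<in> edges D" for e
    using edge_warping_degree_le[OF assms(1) that] assms(2)
    by (simp add: power_diff power_inverse divide_inverse)
  then show "poly (map_poly of_int (warping_polynomial (mirror_diagram D))) t =
      t ^ crossing_number D * poly (map_poly of_int (warping_polynomial D)) (inverse t)"
    unfolding warping_polynomial_mirror[OF assms(1)] warping_polynomial_def[of D]
    by (simp add: poly_of_int_sum_monom sum_distrib_left)
qed

end
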